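(* Let $\alpha,\beta,a,b,c,z,p\in\mathbb{C}$ with $\mathrm{Re}(\alpha)>-1$, with $\mathrm{Re}(p)>0$ or $p=0$, with $\mathrm{Re}(c)>\mathrm{Re}(b)>0$, and with $|\arg(1-z)|<\pi$. Then $${}^{\Psi}F_{p}^{(\alpha,\beta)}(a,b;c;z)=(1-z)^{-a}\;{}^{\Psi}F_{p}^{(\alpha,\beta)}\left( a,c-b;c;\frac{z}{z-1}\right).$$
   Context: For $\alpha,\beta\in\mathbb{C}$ with $\mathrm{Re}(\alpha)>-1$, the Wright function is ${}_{0}\Psi_{1}(\alpha,\beta;z)=\sum_{n=0}^{\infty}\frac{1}{\Gamma(\alpha n+\beta)}\frac{z^n}{n!}$ (with $1/\Gamma$ equal to $0$ at the poles of $\Gamma$). The $\Psi$-beta function is, for $\mathrm{Re}(x)>0$, $\mathrm{Re}(y)>0$ and $\mathrm{Re}(p)>0$ (or $p=0$, by the same formula), $${}^{\Psi}B_{p}^{(\alpha,\beta)}(x,y)=\int_{0}^{1}t^{x-1}(1-t)^{y-1}\,{}_{0}\Psi_{1}\left(\alpha,\beta;-\frac{p}{t(1-t)}\right)dt.$$ The $\Psi$-Gauss hypergeometric function is $${}^{\Psi}F_{p}^{(\alpha,\beta)}(a,b;c;z)=\sum_{n=0}^{\infty}(a)_{n}\frac{{}^{\Psi}B_{p}^{(\alpha,\beta)}(b+n,c-b)}{B(b,c-b)}\frac{z^{n}}{n!},$$ and for $z$ with $|\arg(1-z)|<\pi$ outside the disc of convergence it is understood as the analytic continuation of this series in $z$.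 Here $B$ is the classical beta function, $(a)_0=1$, $(a)_n=a(a+1)\cdots(a+n-1)$, and complex powers take principal values.
   Formalization: The formal theorem adds the hypothesis that the integral defining the Ψ-beta function at (b, c-b) converges; under the stated conditions it can diverge (e.g. α = β = 1, p non-real with Re p > 0), and then the series is undefined. *)

theory Defs
  imports "HOL-Analysis.Analysis" "HOL-Complex_Analysis.Complex_Analysis"
begin

text \<open>\<^const>\<open>rGamma\<close> is the entire function $1/\Gamma$, which vanishes at the poles of $\Gamma$.\<close>

definition Wright :: "complex \<Rightarrow> complex \<Rightarrow> complex \<Rightarrow> complex" where
  "Wright \<alpha> \<beta> z = (\<Sum>n. rGamma (\<alpha> * of_nat n + \<beta>) * (z ^ n / fact n))"

definition Psi_Beta_integrand ::
    "complex \<Rightarrow> complex \<Rightarrow> complex \<Rightarrow> complex \<Rightarrow> complex \<Rightarrow> real \<Rightarrow> complex" where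
  "Psi_Beta_integrand \<alpha> \<beta> p x y t =
     of_real t powr (x - 1) * of_real (1 - t) powr (y - 1)
       * Wright \<alpha> \<beta> (- p / of_real (t * (1 - t)))"

text \<open>
  The integral is a Henstock--Kurzweil integral. It agrees with the Lebesgue integral when
  the latter exists, and it also covers improper integrals that converge only conditionally,
  as happens for oscillating Wright functions. The values of the integrand at the
  end points are irrelevant. If the integral diverges, the library assigns it the value 0.
\<close>

definition Psi_Beta :: "complex \<Rightarrow> complex \<Rightarrow> complex \<Rightarrow> complex \<Rightarrow> complex \<Rightarrow> complex" where
  "Psi_Beta \<alpha> \<beta> p x y = integral {0..1} (Psi_Beta_integrand \<alpha> \<beta> p x y)"

definition Psi_F_fps ::
    "complex \<Rightarrow> complex \<Rightarrow> complex \<Rightarrow> complex \<Rightarrow> complex \<Rightarrow> complex \<Rightarrow> complex fps" where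
  "Psi_F_fps \<alpha> \<beta> p a b c =
     Abs_fps (\<lambda>n. pochhammer a n * (Psi_Beta \<alpha> \<beta> p (b + of_nat n) (c - b) / Beta b (c - b))
                    / fact n)"

text \<open>
  The plane cut along $[1,\infty)$. The point 1 has to be excluded explicitly,
  because in the library \<^term>\<open>Arg 0 = 0\<close>.
\<close>

definition cut_plane :: "complex set" where
  "cut_plane = {z. z \<noteq> 1 \<and> \<bar>Arg (1 - z)\<bar> < pi}"

definition is_continuation :: "complex fps \<Rightarrow> (complex \<Rightarrow> complex) \<Rightarrow> bool" where
  "is_continuation f g \<longleftrightarrow>
     g holomorphic_on cut_plane \<and>
     (\<forall>z \<in> cut_plane \<inter> eball 0 (fps_conv_radius f). g z = eval_fps f z)"

text \<open>
  A continuation is determined only on the cut plane, so the description picks out its value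
  at the given point and not the function itself.
\<close>

definition Psi_F ::
    "complex \<Rightarrow> complex \<Rightarrow> complex \<Rightarrow> complex \<Rightarrow> complex \<Rightarrow> complex \<Rightarrow> complex \<Rightarrow> complex" where
  "Psi_F \<alpha> \<beta> p a b c z =
     (let f = Psi_F_fps \<alpha> \<beta> p a b c in
      if z \<in> eball 0 (fps_conv_radius f) then eval_fps f z
      else (THE w. \<exists>g. is_continuation f g \<and> w = g z))"

end

theory Submission
  imports Defs
begin

text \<open>
  The proof is the classical one for the Pfaff transformation, by way of the Euler integral.
  Put \<open>f t = t\<^sup>b\<^sup>-\<^sup>1 (1 - t)\<^sup>c\<^sup>-\<^sup>b\<^sup>-\<^sup>1 W t\<close>, where \<open>W t\<close> is the Wright function at \<open>- p / (t (1 - t))\<close>.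
  The coefficients of the hypergeometric series are the moments of \<open>f\<close>, and expanding
  \<open>(1 - z t)\<^sup>-\<^sup>a\<close> by the binomial series shows that the function is, on the whole cut plane,
  the integral of \<open>(1 - z t)\<^sup>-\<^sup>a f t\<close> over the unit interval, divided by the beta function
  (\<open>Psi_F_eq_integral\<close>). The substitution of \<open>1 - t\<close> for \<open>t\<close> leaves \<open>W\<close> unchanged, swaps \<open>b\<close>
  and \<open>c - b\<close>, and turns the kernel into \<open>(1 - z)\<^sup>-\<^sup>a (1 - z t / (z - 1))\<^sup>-\<^sup>a\<close>
  (\<open>pfaff_kernel_identity\<close>).

  The analytic difficulty is that \<open>f\<close> is only assumed to be Henstock--Kurzweil integrable.
  Dominated convergence would require absolute integrability, so neither the interchange of sum
  and integral nor the holomorphy in \<open>z\<close> can be obtained in the usual manner. Both follow from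
  integration by parts (\<open>integral_by_parts_C1\<close>): the kernel is continuously differentiable in
  \<open>t\<close>, and the indefinite integral of \<open>f\<close> is continuous, so one is left with integrals of
  continuous functions, for which uniform convergence and the Leibniz rule are available
  (\<open>integral_power_series_times_integrable\<close>, \<open>holomorphic_binomial_kernel_integral\<close>).
\<close>

section \<open>Integration by parts for Henstock--Kurzweil integrals\<close>

text \<open>
  A Henstock--Kurzweil integrable \<open>f\<close> need not be continuous or absolutely integrable, so its
  indefinite integral \<open>F\<close> need not be differentiable everywhere, and the usual proof, which
  differentiates \<open>h F\<close>, is not available. Instead let \<open>\<phi> x\<close> be the difference of the two
  sides of the formula on \<open>[a, x]\<close>. On a subinterval \<open>[u, v]\<close> the second mean value theorem
  for the increasing function \<open>h\<close> turns \<open>\<phi> v - \<phi> u\<close> into the integral of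
  \<open>h' s (F s - F c)\<close> for some \<open>c\<close> in \<open>[u, v]\<close>. As \<open>F\<close> is uniformly continuous and \<open>h'\<close> is
  bounded, this is \<open>o(v - u)\<close>. So \<open>\<phi>\<close> has derivative zero and is constant.
\<close>

lemma integral_by_parts_mono:
  fixes f h h' :: "real \<Rightarrow> real"
  assumes ab: "a \<le> b" and f: "f integrable_on {a..b}"
    and mono: "\<And>x y. a \<le> x \<Longrightarrow> x \<le> y \<Longrightarrow> y \<le> b \<Longrightarrow> h x \<le> h y"
    and deriv: "\<And>x. x \<in> {a..b} \<Longrightarrow> (h has_vector_derivative h' x) (at x within {a..b})"
    and cont: "continuous_on {a..b} h'"
  shows "((\<lambda>x. h x * f x) has_integral
           (h b * integral {a..b} f - integral {a..b} (\<lambda>x. h' x * integral {a..x} f))) {a..b}"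
proof -
  define F where "F x = integral {a..x} f" for x
  have contF: "continuous_on {a..b} F"
    unfolding F_def by (rule indefinite_integral_continuous_1[OF f])
  have hf: "(\<lambda>x. h x * f x) integrable_on {a..b}"
    by (rule second_mean_value_theorem_full[OF f ab, of h, OF mono]) (auto simp: integrable_on_def)
  have h'F: "(\<lambda>x. h' x * F x) integrable_on {a..b}"
    by (intro integrable_continuous_interval continuous_intros cont contF)
  obtain K where K: "K > 0" "\<And>x. x \<in> {a..b} \<Longrightarrow> \<bar>h' x\<bar> \<le> K"
  proof -
    have "bounded (h' ` {a..b})"
      using compact_continuous_image[OF cont] by (simp add: compact_imp_bounded)
    then obtain K where "\<forall>x\<in>{a..b}. \<bar>h' x\<bar> \<le> K"
      unfolding bounded_iff by auto
    then show ?thesis by (intro that[of "max K 1"]) (auto simp: le_max_iff_disj)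
  qed
  define \<phi> where "\<phi> x = integral {a..x} (\<lambda>x. h x * f x) - h x * F x + integral {a..x} (\<lambda>x. h' x * F x)" for x
  have incr: "\<exists>c\<in>{u..v}. \<phi> v - \<phi> u = integral {u..v} (\<lambda>s. h' s * (F s - F c))"
    if uv: "a \<le> u" "u \<le> v" "v \<le> b" for u v
  proof -
    have sub: "{u..v} \<subseteq> {a..b}" using uv by auto
    have split: "integral {a..y} g - integral {a..x} g = integral {x..y} g"
      if "a \<le> x" "x \<le> y" "y \<le> b" "g integrable_on {a..b}" for x y and g :: "real \<Rightarrow> real"
      using Henstock_Kurzweil_Integration.integral_combine[of a x y g] that
        integrable_on_subinterval[of g "{a..b}" a y] by auto
    obtain c where c: "c \<in> {u..v}"
      and hfc: "integral {u..v} (\<lambda>x. h x * f x) = h u * integral {u..c} f + h v * integral {c..v} f"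
      by (rule second_mean_value_theorem[of f u v h])
         (use uv in \<open>auto intro: mono integrable_on_subinterval[OF f sub]\<close>)
    have h'i: "(h' has_integral (h v - h u)) {u..v}"
      by (rule fundamental_theorem_of_calculus)
         (use uv sub in \<open>auto intro: has_vector_derivative_within_subset[OF deriv]\<close>)
    have "integral {u..v} (\<lambda>s. h' s * (F s - F c)) = 
          integral {u..v} (\<lambda>s. h' s * F s) - (h v - h u) * F c"
      using has_integral_diff[OF integrable_integral[OF integrable_on_subinterval[OF h'F sub]]
              has_integral_mult_left[OF h'i, of "F c"]]
      by (intro integral_unique) (simp add: algebra_simps)
    moreover have "integral {u..c} f = F c - F u" "integral {c..v} f = F v - F c"
      using split[of u c f] split[of c v f] c uv f by (auto simp: F_def)
    moreover have "\<phi> v - \<phi> u = integral {u..v} (\<lambda>x. h x * f x) - (h v * F v - h u * F u)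
        + integral {u..v} (\<lambda>x. h' x * F x)"
      using split[OF uv hf] split[OF uv h'F] by (simp add: \<phi>_def)
    ultimately have "\<phi> v - \<phi> u = integral {u..v} (\<lambda>s. h' s * (F s - F c))"
      unfolding hfc by algebra
    with c show ?thesis by (rule rev_bexI)
  qed
  have small: "\<exists>d>0. \<forall>u v. a \<le> u \<longrightarrow> u \<le> v \<longrightarrow> v \<le> b \<longrightarrow> v - u < d \<longrightarrow> \<bar>\<phi> v - \<phi> u\<bar> \<le> e * (v - u)"
    if e: "e > 0" for e
  proof -
    have "uniformly_continuous_on {a..b} F"
      by (intro compact_uniformly_continuous contF) auto
    moreover have "e / K > 0" using e K(1) by simp
    ultimately obtain d where d: "d > 0"
      "\<And>x y. x \<in> {a..b} \<Longrightarrow> y \<in> {a..b} \<Longrightarrow> \<bar>x - y\<bar> < d \<Longrightarrow> \<bar>F x - F y\<bar> < e / K"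
      unfolding uniformly_continuous_on_def dist_real_def by blast
    have "\<bar>\<phi> v - \<phi> u\<bar> \<le> e * (v - u)" if uv: "a \<le> u" "u \<le> v" "v \<le> b" "v - u < d" for u v
    proof -
      obtain c where c: "c \<in> {u..v}" "\<phi> v - \<phi> u = integral {u..v} (\<lambda>s. h' s * (F s - F c))"
        using incr[OF uv(1-3)] by blast
      have bd: "norm (h' s * (F s - F c)) \<le> e" if s: "s \<in> {u..v}" for s
      proof -
        have "\<bar>s - c\<bar> < d" using s c uv by auto
        then have "\<bar>F s - F c\<bar> < e / K" using d(2)[of s c] s c uv by auto
        then have "\<bar>h' s\<bar> * \<bar>F s - F c\<bar> \<le> K * (e / K)"
          using K s c uv by (intro mult_mono) auto
        then show ?thesis using K by (simp add: abs_mult)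
      qed
      have "(\<lambda>s. h' s * (F s - F c)) integrable_on {u..v}"
        by (intro integrable_continuous_interval continuous_intros
            continuous_on_subset[OF cont] continuous_on_subset[OF contF]) (use uv in auto)
      from integrable_integral[OF this] have "norm (integral {u..v} (\<lambda>s. h' s * (F s - F c))) \<le> e * measure lborel {u..v}"
        by (rule has_integral_bound_real[OF less_imp_le[OF e] finite.emptyI]) (use bd in auto)
      then show ?thesis using c uv by simp
    qed
    with d(1) show ?thesis by metis
  qed
  have "\<phi> b = \<phi> a"
  proof -
    have "(\<phi> has_derivative (\<lambda>_. 0)) (at x within {a..b})" if "x \<in> {a..b}" for x
      unfolding has_derivative_within_alt
    proof (intro conjI allI impI)
      fix e :: real assume "e > 0"
      from small[OF this] obtain d where d: "d > 0"
        "\<And>u v. a \<le> u \<Longrightarrow> u \<le> v \<Longrightarrow> v \<le> b \<Longrightarrow> v - u < d \<Longrightarrow> \<bar>\<phi> v - \<phi> u\<bar> \<le> e * (v - u)"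
        by blast
      have "\<bar>\<phi> y - \<phi> x\<bar> \<le> e * \<bar>y - x\<bar>" if "y \<in> {a..b}" "\<bar>y - x\<bar> < d" for y
        using d(2)[of x y] d(2)[of y x] that \<open>x \<in> {a..b}\<close> by (cases "x \<le> y") (auto simp: abs_minus_commute)
      with d show "\<exists>d>0. \<forall>y\<in>{a..b}. norm (y - x) < d \<longrightarrow>
          norm (\<phi> y - \<phi> x - 0) \<le> e * norm (y - x)" by auto
    qed auto
    then show ?thesis
      using has_derivative_zero_constant[of "{a..b}" \<phi>] ab by force
  qed
  then have "integral {a..b} (\<lambda>x. h x * f x) = h b * F b - integral {a..b} (\<lambda>x. h' x * F x)"
    by (simp add: \<phi>_def F_def)
  then have "((\<lambda>x. h x * f x) has_integral (h b * F b - integral {a..b} (\<lambda>x. h' x * F x))) {a..b}"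
    using integrable_integral[OF hf] by simp
  then show ?thesis by (simp add: F_def)
qed

text \<open>
  A function with a bounded derivative is a difference of two increasing ones: if \<open>K\<close> bounds
  \<open>\<bar>h'\<bar>\<close>, then \<open>h x + K x\<close> and \<open>K x\<close> are increasing, and the formula is linear in \<open>h\<close>.
\<close>

lemma integral_by_parts_real:
  fixes f h h' :: "real \<Rightarrow> real"
  assumes ab: "a \<le> b" and f: "f integrable_on {a..b}"
    and deriv: "\<And>x. x \<in> {a..b} \<Longrightarrow> (h has_vector_derivative h' x) (at x within {a..b})"
    and cont: "continuous_on {a..b} h'"
  shows "((\<lambda>x. h x * f x) has_integral
           (h b * integral {a..b} f - integral {a..b} (\<lambda>x. h' x * integral {a..x} f))) {a..b}"
proof -
  have "bounded (h' ` {a..b})"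
    using compact_continuous_image[OF cont] by (simp add: compact_imp_bounded)
  then obtain K where "\<forall>x\<in>{a..b}. \<bar>h' x\<bar> \<le> K"
    unfolding bounded_iff by auto
  then have K: "\<And>x. x \<in> {a..b} \<Longrightarrow> \<bar>h' x\<bar> \<le> K" by blast
  have K0: "K \<ge> 0" using K[of a] ab by auto
  have contF: "continuous_on {a..b} (\<lambda>x. integral {a..x} f)"
    by (rule indefinite_integral_continuous_1[OF f])
  have int: "(\<lambda>x. g x * integral {a..x} f) integrable_on {a..b}"
    if "continuous_on {a..b} g" for g :: "real \<Rightarrow> real"
    by (intro integrable_continuous_interval continuous_intros that contF)
  have d1: "((\<lambda>x. h x + K * x) has_vector_derivative (h' x + K)) (at x within {a..b})"
    if "x \<in> {a..b}" for x
    using deriv[OF that] by (auto intro!: derivative_eq_intros)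
  have d2: "((\<lambda>x. K * x) has_vector_derivative K) (at x within {a..b})" for x
    by (auto intro!: derivative_eq_intros)
  have mono: "h x + K * x \<le> h y + K * y" if "a \<le> x" "x \<le> y" "y \<le> b" for x y
  proof -
    have "((\<lambda>x. h' x + K) has_integral ((h y + K * y) - (h x + K * x))) {x..y}"
      by (rule fundamental_theorem_of_calculus)
         (use that in \<open>auto intro: has_vector_derivative_within_subset[OF d1]\<close>)
    moreover have "h' s + K \<ge> 0" if "s \<in> {x..y}" for s
      using K[of s] that \<open>a \<le> x\<close> \<open>y \<le> b\<close> by auto
    ultimately have "0 \<le> (h y + K * y) - (h x + K * x)" by (rule has_integral_nonneg)
    then show ?thesis by simp
  qed
  have "((\<lambda>x. (h x + K * x) * f x) has_integral
      ((h b + K * b) * integral {a..b} f - integral {a..b} (\<lambda>x. (h' x + K) * integral {a..x} f))) {a..b}"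
    by (rule integral_by_parts_mono[OF ab f mono d1]) (auto intro!: continuous_intros cont)
  moreover have "((\<lambda>x. K * x * f x) has_integral
      (K * b * integral {a..b} f - integral {a..b} (\<lambda>x. K * integral {a..x} f))) {a..b}"
    by (rule integral_by_parts_mono[OF ab f])
       (use K0 in \<open>auto simp: mult_left_mono intro: d2\<close>)
  ultimately have "((\<lambda>x. (h x + K * x) * f x - K * x * f x) has_integral
      ((h b + K * b) * integral {a..b} f - integral {a..b} (\<lambda>x. (h' x + K) * integral {a..x} f)
       - (K * b * integral {a..b} f - integral {a..b} (\<lambda>x. K * integral {a..x} f)))) {a..b}"
    by (rule has_integral_diff)
  moreover have "integral {a..b} (\<lambda>x. (h' x + K) * integral {a..x} f) =
      integral {a..b} (\<lambda>x. h' x * integral {a..x} f) + integral {a..b} (\<lambda>x. K * integral {a..x} f)"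
    using integral_add[OF int[OF cont] int[of "\<lambda>_. K"]] by (simp add: algebra_simps)
  ultimately show ?thesis by (simp add: algebra_simps)
qed

text \<open>
  Both sides are bilinear in \<open>h\<close> and \<open>f\<close>, so the complex formula is the sum of four real ones.
  The formula trades the integrand \<open>h f\<close>, whose integral may converge only conditionally, for
  the continuous integrand \<open>h' F\<close>.
\<close>

lemma integral_by_parts_C1:
  fixes f h h' :: "real \<Rightarrow> complex"
  assumes ab: "a \<le> b" and f: "f integrable_on {a..b}"
    and deriv: "\<And>x. x \<in> {a..b} \<Longrightarrow> (h has_vector_derivative h' x) (at x within {a..b})"
    and cont: "continuous_on {a..b} h'"
  shows "((\<lambda>x. h x * f x) has_integral
           (h b * integral {a..b} f - integral {a..b} (\<lambda>x. h' x * integral {a..x} f))) {a..b}"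
proof -
  let ?F = "\<lambda>x. integral {a..x} f"
  have contF: "continuous_on {a..b} ?F"
    by (rule indefinite_integral_continuous_1[OF f])
  have ReIm: "(\<lambda>x. Re (f x)) integrable_on {a..b}" "(\<lambda>x. Im (f x)) integrable_on {a..b}"
    using integrable_linear[OF f bounded_linear_Re] integrable_linear[OF f bounded_linear_Im]
    by (auto simp: o_def)
  have F: "integral {a..x} (\<lambda>x. Re (f x)) = Re (?F x)" "integral {a..x} (\<lambda>x. Im (f x)) = Im (?F x)"
    if "x \<in> {a..b}" for x
    using integral_linear[OF integrable_on_subinterval[OF f] bounded_linear_Re, of a x]
      integral_linear[OF integrable_on_subinterval[OF f] bounded_linear_Im, of a x] that
    by (auto simp: o_def)
  have dh: "((\<lambda>x. Re (h x)) has_vector_derivative Re (h' x)) (at x within {a..b})"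
    "((\<lambda>x. Im (h x)) has_vector_derivative Im (h' x)) (at x within {a..b})" if "x \<in> {a..b}" for x
    using bounded_linear.has_vector_derivative[OF bounded_linear_Re deriv[OF that]]
      bounded_linear.has_vector_derivative[OF bounded_linear_Im deriv[OF that]] by auto
  have ch: "continuous_on {a..b} (\<lambda>x. Re (h' x))" "continuous_on {a..b} (\<lambda>x. Im (h' x))"
    by (intro continuous_intros cont)+
  have parts: "((\<lambda>x. p (h x) * q (f x)) has_integral
      p (h b) * q (?F b) - integral {a..b} (\<lambda>x. p (h' x) * q (?F x))) {a..b}"
    if "p \<in> {Re, Im}" "q \<in> {Re, Im}" for p q
  proof -
    have qF: "integral {a..x} (\<lambda>x. q (f x)) = q (?F x)" if "x \<in> {a..b}" for x
      using F[OF that] \<open>q \<in> _\<close> by auto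
    have "((\<lambda>x. p (h x) * q (f x)) has_integral p (h b) * integral {a..b} (\<lambda>x. q (f x))
        - integral {a..b} (\<lambda>x. p (h' x) * integral {a..x} (\<lambda>x. q (f x)))) {a..b}"
      by (rule integral_by_parts_real[OF ab]) (use that ReIm dh ch in auto)
    also have "integral {a..b} (\<lambda>x. p (h' x) * integral {a..x} (\<lambda>x. q (f x)))
        = integral {a..b} (\<lambda>x. p (h' x) * q (?F x))"
      by (rule integral_cong) (simp add: qF)
    finally show ?thesis using ab by (simp add: qF)
  qed
  have int: "(\<lambda>x. p (h' x) * q (?F x)) integrable_on {a..b}" if "p \<in> {Re, Im}" "q \<in> {Re, Im}" for p q
    using that by (auto intro!: integrable_continuous_interval continuous_intros cont contF)
  have intc: "(\<lambda>x. h' x * ?F x) integrable_on {a..b}"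
    by (intro integrable_continuous_interval continuous_intros cont contF)
  let ?I = "integral {a..b} (\<lambda>x. h' x * ?F x)"
  have ReI: "Re ?I =
      integral {a..b} (\<lambda>x. Re (h' x) * Re (?F x)) - integral {a..b} (\<lambda>x. Im (h' x) * Im (?F x))"
    using integral_linear[OF intc bounded_linear_Re] integral_diff[OF int[of Re Re] int[of Im Im]]
    by (simp add: o_def)
  have ImI: "Im ?I =
      integral {a..b} (\<lambda>x. Re (h' x) * Im (?F x)) + integral {a..b} (\<lambda>x. Im (h' x) * Re (?F x))"
    using integral_linear[OF intc bounded_linear_Im] integral_add[OF int[of Re Im] int[of Im Re]]
    by (simp add: o_def)
  have "((\<lambda>x. Re (h x * f x)) has_integral Re (h b * ?F b - ?I)) {a..b}"
    using has_integral_diff[OF parts[of Re Re] parts[of Im Im]] by (simp add: ReI algebra_simps)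
  moreover have "((\<lambda>x. Im (h x * f x)) has_integral Im (h b * ?F b - ?I)) {a..b}"
    using has_integral_add[OF parts[of Re Im] parts[of Im Re]] by (simp add: ImI algebra_simps)
  ultimately show ?thesis
    by (subst has_integral_componentwise_iff) (simp add: Basis_complex_def)
qed

section \<open>Termwise integration of power series\<close>

text \<open>
  Termwise integration needs more than uniform convergence of the series here, because \<open>f\<close> may
  fail to be absolutely integrable. After integration by parts the integrand contains the
  derivative of the series and the continuous function \<open>F\<close>, and the derivatives of the partial
  sums converge uniformly on the closed disc of radius \<open>norm z\<close>.
\<close>

lemma integral_power_series_times_integrable:
  fixes C :: "complex fps" and f :: "real \<Rightarrow> complex"
  assumes f: "f integrable_on {0..1}" and z: "ereal (norm z) < fps_conv_radius C"
  shows "(\<lambda>n. fps_nth C n * integral {0..1} (\<lambda>t. of_real t ^ n * f t) * z ^ n) sums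
           integral {0..1} (\<lambda>t. eval_fps C (z * of_real t) * f t)"
proof -
  define F where "F t = integral {0..t} f" for t
  define S where "S N w = (\<Sum>i<N. fps_nth C i * w ^ i)" for N w
  define D where "D N w = (\<Sum>i<N. fps_nth (fps_deriv C) i * w ^ i)" for N w
  have zD: "ereal (norm z) < fps_conv_radius (fps_deriv C)"
    using z fps_conv_radius_deriv[of C] by (rule less_le_trans)
  have zt: "z * of_real t \<in> cball 0 (norm z)" if "t \<in> {0..1}" for t
    using that by (auto simp: norm_mult mult_left_le)
  have zt_ball: "z * of_real t \<in> eball 0 (fps_conv_radius (fps_deriv C))" 
      "z * of_real t \<in> eball 0 (fps_conv_radius C)" if "t \<in> {0..1}" for t
  proof -
    have "ereal (norm (z * of_real t)) \<le> ereal (norm z)" using zt[OF that] by simp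
    then show "z * of_real t \<in> eball 0 (fps_conv_radius (fps_deriv C))" 
      "z * of_real t \<in> eball 0 (fps_conv_radius C)"
      using z zD by (simp_all only: in_eball_iff dist_0_norm)
  qed
  have contF: "continuous_on {0..1} F"
    unfolding F_def by (rule indefinite_integral_continuous_1[OF f])
  have contD: "continuous_on {0..1} (\<lambda>t. eval_fps (fps_deriv C) (z * of_real t))"
    by (rule continuous_on_compose2[OF continuous_on_eval_fps])
       (use zt_ball in \<open>auto intro!: continuous_intros\<close>)
  have parts: "((\<lambda>t. h (z * of_real t) * f t) has_integral
      (h z * F 1 - integral {0..1} (\<lambda>t. z * h' (z * of_real t) * F t))) {0..1}"
    if hd: "\<And>t. t \<in> {0..1} \<Longrightarrow> (h has_field_derivative h' (z * of_real t)) (at (z * of_real t))"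
      and hc: "continuous_on {0..1} (\<lambda>t. h' (z * of_real t))" for h h'
  proof -
    have "((\<lambda>t. h (z * of_real t)) has_vector_derivative z * h' (z * of_real t)) (at t within {0..1})"
      if "t \<in> {0..1}" for t
    proof -
      have "((\<lambda>w. h (z * w)) has_field_derivative z * h' (z * of_real t)) (at (of_real t))"
        using DERIV_chain2[OF hd[OF that] DERIV_cmult_Id] by (simp add: mult.commute)
      from has_vector_derivative_real_field[OF this] show ?thesis by simp
    qed
    from integral_by_parts_C1[OF _ f this continuous_on_mult_left[OF hc, of z]] show ?thesis
      by (simp add: F_def)
  qed
  have dS: "(S (Suc N) has_field_derivative D N w) (at w)" for N w
  proof -
    have "(S (Suc N) has_field_derivative (\<Sum>i<Suc N. fps_nth C i * (of_nat i * w ^ (i - 1)))) (at w)"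
      unfolding S_def by (intro DERIV_sum) (auto intro!: derivative_eq_intros)
    also have "(\<Sum>i<Suc N. fps_nth C i * (of_nat i * w ^ (i - 1))) = D N w"
      unfolding D_def sum.lessThan_Suc_shift by (simp add: mult_ac)
    finally show ?thesis .
  qed
  \<comment> \<open>\<open>S (Suc N)\<close> is paired with \<open>D N\<close> since differentiation lowers the degree by one.\<close>
  have lim_parts: "(\<lambda>N. S (Suc N) z * F 1 - integral {0..1} (\<lambda>t. z * D N (z * of_real t) * F t))
     \<longlonglongrightarrow> eval_fps C z * F 1 - integral {0..1} (\<lambda>t. z * eval_fps (fps_deriv C) (z * of_real t) * F t)"
  proof (intro tendsto_diff tendsto_mult tendsto_const)
    show "(\<lambda>N. S (Suc N) z) \<longlonglongrightarrow> eval_fps C z"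
      using sums_eval_fps[OF z] unfolding sums_def S_def by (rule LIMSEQ_Suc)
    have "uniform_limit (cball 0 (norm z)) D (eval_fps (fps_deriv C)) sequentially"
      using powser_uniform_limit[of "norm z" "fps_nth (fps_deriv C)" 0] zD
      by (simp add: fps_conv_radius_def D_def[abs_def] eval_fps_def[abs_def])
    from uniform_limit_compose'[OF this, of "\<lambda>t. z * of_real t" "{0..1}"] zt
    have "uniform_limit {0..1} (\<lambda>N t. D N (z * of_real t)) 
             (\<lambda>t. eval_fps (fps_deriv C) (z * of_real t)) sequentially" by auto
    then have u: "uniform_limit {0..1} (\<lambda>N t. z * D N (z * of_real t) * F t)
             (\<lambda>t. z * eval_fps (fps_deriv C) (z * of_real t) * F t) sequentially"
      by (intro uniform_lim_mult uniform_limit_const)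
         (auto intro!: compact_imp_bounded compact_continuous_image continuous_intros contD contF)
    have c: "continuous_on {0..1} (\<lambda>t. z * D N (z * of_real t) * F t)" for N
      unfolding D_def by (intro continuous_intros contF)
    obtain I J where IJ: "\<And>n. ((\<lambda>t. z * D n (z * of_real t) * F t) has_integral I n) {0..1}"
      "((\<lambda>t. z * eval_fps (fps_deriv C) (z * of_real t) * F t) has_integral J) {0..1}" "I \<longlonglongrightarrow> J"
      by (rule uniform_limit_integral[OF u c]) auto
    show "(\<lambda>n. integral {0..1} (\<lambda>t. z * D n (z * of_real t) * F t)) \<longlonglongrightarrow>
        integral {0..1} (\<lambda>t. z * eval_fps (fps_deriv C) (z * of_real t) * F t)"
      unfolding integral_unique[OF IJ(1)] integral_unique[OF IJ(2)] by (fact IJ(3))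
  qed
  have full: "integral {0..1} (\<lambda>t. eval_fps C (z * of_real t) * f t) =
      eval_fps C z * F 1 - integral {0..1} (\<lambda>t. z * eval_fps (fps_deriv C) (z * of_real t) * F t)"
    by (intro integral_unique parts has_field_derivative_eval_fps contD)
       (use zt_ball in \<open>auto simp: in_eball_iff\<close>)
  have moment: "(\<lambda>t. of_real t ^ n * f t) integrable_on {0..1}" for n
  proof -
    have d: "((\<lambda>t. complex_of_real t ^ n) has_vector_derivative of_nat n * of_real t ^ (n - 1)) (at t within {0..1})" for t
      by (rule has_vector_derivative_real_field) (auto intro!: derivative_eq_intros)
    have "continuous_on {0..1} (\<lambda>t. of_nat n * complex_of_real t ^ (n - 1))"
      by (intro continuous_intros)
    from integral_by_parts_C1[OF _ f d this] show ?thesis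
      by (auto simp: integrable_on_def)
  qed
  have partial_sums: "S (Suc N) z * F 1 - integral {0..1} (\<lambda>t. z * D N (z * of_real t) * F t) =
      (\<Sum>n<Suc N. fps_nth C n * integral {0..1} (\<lambda>t. of_real t ^ n * f t) * z ^ n)" for N
  proof (rule has_integral_unique)
    show "((\<lambda>t. S (Suc N) (z * of_real t) * f t) has_integral
      (S (Suc N) z * F 1 - integral {0..1} (\<lambda>t. z * D N (z * of_real t) * F t))) {0..1}"
      by (rule parts[OF dS]) (auto simp: D_def intro!: continuous_intros)
    have "((\<lambda>t. \<Sum>n<Suc N. fps_nth C n * (of_real t ^ n * f t) * z ^ n) has_integral
      (\<Sum>n<Suc N. fps_nth C n * integral {0..1} (\<lambda>t. of_real t ^ n * f t) * z ^ n)) {0..1}"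
      by (intro has_integral_sum has_integral_mult_right has_integral_mult_left
            integrable_integral moment) auto
    also have "(\<lambda>t. \<Sum>n<Suc N. fps_nth C n * (of_real t ^ n * f t) * z ^ n) =
       (\<lambda>t. S (Suc N) (z * of_real t) * f t)"
      unfolding S_def sum_distrib_right by (simp only: power_mult_distrib mult_ac)
    finally show "((\<lambda>t. S (Suc N) (z * of_real t) * f t) has_integral
      (\<Sum>n<Suc N. fps_nth C n * integral {0..1} (\<lambda>t. of_real t ^ n * f t) * z ^ n)) {0..1}" .
  qed
  show ?thesis
    unfolding sums_def full by (rule LIMSEQ_imp_Suc) (use lim_parts in \<open>simp only: partial_sums\<close>)
qed

section \<open>The cut plane and the binomial kernel\<close>

lemma cut_plane_iff: "z \<in> cut_plane \<longleftrightarrow> 1 - z \<notin> \<real>\<^sub>\<le>\<^sub>0"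
proof -
  have "\<bar>Arg (1 - z)\<bar> < pi \<longleftrightarrow> Arg (1 - z) \<noteq> pi"
    using Arg_bounded[of "1 - z"] by auto
  then show ?thesis
    by (auto simp: cut_plane_def Arg_eq_pi complex_nonpos_Reals_iff complex_eq_iff)
qed

lemma open_cut_plane: "open cut_plane"
proof -
  have "cut_plane = (\<lambda>z. 1 - z) -` (- \<real>\<^sub>\<le>\<^sub>0)"
    by (auto simp: cut_plane_iff)
  moreover have "open ((\<lambda>z. 1 - z) -` (- \<real>\<^sub>\<le>\<^sub>0 :: complex set))"
    by (intro continuous_open_vimage open_Compl) (auto intro!: continuous_intros)
  ultimately show ?thesis by simp
qed

lemma cut_plane_scaled:
  assumes "z \<in> cut_plane" "t \<in> {0..1}"
  shows "z * of_real t \<in> cut_plane"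
proof (cases "Im z = 0")
  case True
  then have "Re z < 1"
    using assms by (auto simp: cut_plane_iff complex_nonpos_Reals_iff)
  moreover have "Re z * t \<le> max 0 (Re z)"
    using assms(2) by (cases "Re z \<ge> 0") (auto simp: mult_left_le mult_nonpos_nonneg)
  ultimately show ?thesis
    by (auto simp: cut_plane_iff complex_nonpos_Reals_iff)
next
  case False
  then show ?thesis
    using assms(2) by (cases "t = 0") (auto simp: cut_plane_iff complex_nonpos_Reals_iff)
qed

text \<open>
  The set is star-shaped about 0. The radius may exceed 1 (for instance, it is infinite if the
  series terminates), and then the disc sticks out across the cut, so that convexity is not
  available.
\<close>

lemma connected_cut_plane_eball:
  assumes "r > 0"
  shows "connected (cut_plane \<inter> eball 0 r)"
proof (rule starlike_imp_connected)
  have "closed_segment 0 z \<subseteq> cut_plane \<inter> eball 0 r" if z: "z \<in> cut_plane \<inter> eball 0 r" for z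
  proof
    fix w assume "w \<in> closed_segment 0 z"
    then obtain t where t: "t \<in> {0..1}" "w = z * of_real t"
      by (auto simp: in_segment scaleR_conv_of_real mult.commute)
    have "ereal (norm w) \<le> ereal (norm z)"
      using t by (auto simp: norm_mult mult_left_le)
    also have "\<dots> < r" using z by simp
    finally show "w \<in> cut_plane \<inter> eball 0 r"
      using z t cut_plane_scaled by auto
  qed
  moreover have "0 \<in> cut_plane \<inter> eball 0 r"
    using assms by (auto simp: cut_plane_iff zero_ereal_def)
  ultimately show "starlike (cut_plane \<inter> eball 0 r)"
    unfolding starlike_def by blast
qed

lemma unit_ball_subset_cut_plane: "ball 0 1 \<subseteq> cut_plane"
proof
  fix z :: complex assume "z \<in> ball 0 1"
  then have "Re z < 1" using complex_Re_le_cmod[of z] by auto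
  then show "z \<in> cut_plane" by (auto simp: cut_plane_iff complex_nonpos_Reals_iff)
qed

lemma binomial_kernel_deriv:
  fixes z w s :: complex
  assumes "1 - z * w \<notin> \<real>\<^sub>\<le>\<^sub>0"
  shows "((\<lambda>z. (1 - z * w) powr s) has_field_derivative (- w * s * (1 - z * w) powr (s - 1))) (at z)"
proof -
  have "((\<lambda>z. 1 - z * w) has_field_derivative - w) (at z)"
    by (auto intro!: derivative_eq_intros)
  from DERIV_chain2[where f = "\<lambda>u. u powr s" and g = "\<lambda>z. 1 - z * w", OF has_field_derivative_powr[OF assms] this]
  show ?thesis by (simp add: mult_ac)
qed

text \<open>
  Away from the cut the base avoids the nonpositive reals, so the power can be written as
  \<open>exp (s * Ln (1 - g x))\<close> and any exponent is allowed.
\<close>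

lemma continuous_on_binomial_kernel:
  assumes "continuous_on S g" "\<And>x. x \<in> S \<Longrightarrow> 1 - g x \<notin> \<real>\<^sub>\<le>\<^sub>0"
  shows "continuous_on S (\<lambda>x. (1 - g x) powr (s :: complex))"
proof -
  have "1 - g x \<noteq> 0" if "x \<in> S" for x using assms(2)[OF that] by auto
  then have "continuous_on S (\<lambda>x. (1 - g x) powr s) \<longleftrightarrow> continuous_on S (\<lambda>x. exp (s * Ln (1 - g x)))"
    by (intro continuous_on_cong) (auto simp: powr_def)
  also have "\<dots>" by (intro continuous_intros assms)
  finally show ?thesis .
qed

text \<open>
  Integration by parts moves the dependence on \<open>z\<close> into an integral of the continuous function
  \<open>F\<close> against a jointly continuous kernel, where differentiation under the integral sign is
  legitimate. The Leibniz rule needs a convex domain, so it is applied on small balls.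
\<close>

lemma holomorphic_binomial_kernel_integral:
  fixes f :: "real \<Rightarrow> complex"
  assumes f: "f integrable_on {0..1}"
  shows "(\<lambda>z. integral {0..1} (\<lambda>t. (1 - z * of_real t) powr (- a) * f t)) holomorphic_on cut_plane"
proof -
  define F where "F t = integral {0..t} f" for t
  have contF: "continuous_on {0..1} F"
    unfolding F_def by (rule indefinite_integral_continuous_1[OF f])
  have cut: "1 - z * of_real t \<notin> \<real>\<^sub>\<le>\<^sub>0" if "z \<in> cut_plane" "t \<in> {0..1}" for z t
    using cut_plane_scaled[OF that] by (simp add: cut_plane_iff)
  have cont: "continuous_on {0..1} (\<lambda>t. (1 - z * of_real t) powr s)" if "z \<in> cut_plane" for z s
    by (rule continuous_on_binomial_kernel) (auto intro!: continuous_intros simp: cut[OF that])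
  let ?G = "\<lambda>z t. z * (1 - z * of_real t) powr (- a - 1) * F t"
  have parts: "integral {0..1} (\<lambda>t. (1 - z * of_real t) powr (- a) * f t) =
      (1 - z) powr (- a) * F 1 - a * integral {0..1} (?G z)" if z: "z \<in> cut_plane" for z
  proof -
    have "((\<lambda>t. (1 - z * of_real t) powr (- a)) has_vector_derivative
        a * z * (1 - z * of_real t) powr (- a - 1)) (at t within {0..1})" if "t \<in> {0..1}" for t
      using has_vector_derivative_real_field[OF binomial_kernel_deriv[of "of_real t" z "-a"]]
        cut[OF z that] by (simp add: mult_ac)
    from integral_by_parts_C1[OF _ f this continuous_on_mult_left[OF cont[OF z]]]
    have "integral {0..1} (\<lambda>t. (1 - z * of_real t) powr (- a) * f t) =
      (1 - z) powr (- a) * F 1 - integral {0..1} (\<lambda>t. a * z * (1 - z * of_real t) powr (- a - 1) * F t)"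
      by (simp add: F_def integral_unique)
    also have "integral {0..1} (\<lambda>t. a * z * (1 - z * of_real t) powr (- a - 1) * F t) =
      a * integral {0..1} (?G z)"
      by (subst integral_mult_right[symmetric]) (simp add: mult.assoc)
    finally show ?thesis .
  qed
  have "(\<lambda>z. integral {0..1} (?G z)) analytic_on cut_plane"
    unfolding analytic_on_def
  proof
    fix w assume "w \<in> cut_plane"
    then obtain r where r: "r > 0" "ball w r \<subseteq> cut_plane"
      using open_cut_plane openE by blast
    have "(\<lambda>z. integral (cbox 0 1) (?G z)) holomorphic_on ball w r"
    proof (rule leibniz_rule_holomorphic)
      fix z t assume "z \<in> ball w r" and t: "t \<in> cbox (0::real) 1"
      then have "1 - z * of_real t \<notin> \<real>\<^sub>\<le>\<^sub>0" using r cut by auto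
      from DERIV_cmult_right[OF DERIV_mult[OF DERIV_ident binomial_kernel_deriv[OF this, of "- a - 1"]], of "F t"]
      have "((\<lambda>z. ?G z t) has_field_derivative
          (z * (- of_real t * (- a - 1) * (1 - z * of_real t) powr (- a - 1 - 1))
             + (1 - z * of_real t) powr (- a - 1)) * F t) (at z)"
        by (simp add: mult_ac add_ac)
      then show "((\<lambda>z. ?G z t) has_field_derivative
          (z * (- of_real t * (- a - 1) * (1 - z * of_real t) powr (- a - 1 - 1))
             + (1 - z * of_real t) powr (- a - 1)) * F t) (at z within ball w r)"
        by (rule has_field_derivative_at_within)
    next
      fix z assume "z \<in> ball w r"
      then have "continuous_on {0..1} (?G z)"
        using r by (intro continuous_intros cont contF) auto
      then show "?G z integrable_on cbox 0 1"
        by (auto intro: integrable_continuous_interval)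
    next
      have "1 - fst x * of_real (snd x) \<notin> \<real>\<^sub>\<le>\<^sub>0" if "x \<in> ball w r \<times> cbox 0 1" for x
        using cut[of "fst x" "snd x"] r that by (auto simp: mem_Times_iff)
      then have kernel: "continuous_on (ball w r \<times> cbox 0 1) (\<lambda>x. (1 - fst x * of_real (snd x)) powr s)" for s :: complex
        by (intro continuous_on_binomial_kernel continuous_intros)
      have contF': "continuous_on (ball w r \<times> cbox 0 1) (\<lambda>x. F (snd x))"
        by (rule continuous_on_compose2[OF contF]) (auto intro!: continuous_intros)
      show "continuous_on (ball w r \<times> cbox 0 1) (\<lambda>(z, t).
          (z * (- of_real t * (- a - 1) * (1 - z * of_real t) powr (- a - 1 - 1))
             + (1 - z * of_real t) powr (- a - 1)) * F t)"
        unfolding case_prod_unfold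
        by (intro continuous_on_mult continuous_on_add continuous_on_minus continuous_on_const
            continuous_on_fst continuous_on_snd continuous_on_id continuous_on_of_real kernel contF')
    qed auto
    then show "\<exists>r>0. (\<lambda>z. integral {0..1} (?G z)) holomorphic_on ball w r"
      using r by auto
  qed
  then have "(\<lambda>z. integral {0..1} (?G z)) holomorphic_on cut_plane"
    by (rule analytic_imp_holomorphic)
  then have "(\<lambda>z. (1 - z) powr (- a) * F 1 - a * integral {0..1} (?G z)) holomorphic_on cut_plane"
    by (intro holomorphic_intros) (auto simp: cut_plane_iff)
  then show ?thesis
    by (rule holomorphic_transform) (simp add: parts)
qed

section \<open>The Euler integral\<close>

lemma binomial_series_pochhammer:
  fixes a w :: complex
  assumes "norm w < 1"
  shows "(\<lambda>n. pochhammer a n / fact n * w ^ n) sums (1 - w) powr (- a)"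
proof -
  have "(\<lambda>n. ((- a) gchoose n) * (- w) ^ n) sums (1 + - w) powr (- a)"
    by (rule gen_binomial_complex) (use assms in simp)
  moreover have "((- a) gchoose n) * (- w) ^ n = pochhammer a n / fact n * w ^ n" for n
  proof -
    have "((- a) gchoose n) * (- w) ^ n = pochhammer a n / fact n * ((- 1) ^ n * (- w) ^ n)"
      by (simp add: gbinomial_pochhammer)
    then show ?thesis by (simp flip: power_mult_distrib)
  qed
  ultimately show ?thesis by simp
qed

lemma fps_conv_radius_ge_1:
  fixes C :: "complex fps"
  assumes "\<And>w. norm w < 1 \<Longrightarrow> summable (\<lambda>n. fps_nth C n * w ^ n)"
  shows "fps_conv_radius C \<ge> 1"
  unfolding fps_conv_radius_def
proof (rule conv_radius_geI_ex)
  fix r :: real assume "0 < r" "ereal r < 1"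
  then show "\<exists>w. norm w = r \<and> summable (\<lambda>n. fps_nth C n * w ^ n)"
    using assms[of "of_real r"] by (intro exI[of _ "of_real r"]) (auto simp: one_ereal_def)
qed

text \<open>
  The coefficients of the series are the moments of a single integrand. At \<open>t = 0\<close> both
  integrands vanish, as \<open>0 powr w = 0\<close> for every \<open>w\<close>.
\<close>

lemma Psi_Beta_shift:
  "Psi_Beta \<alpha> \<beta> p (x + of_nat n) y =
     integral {0..1} (\<lambda>t. of_real t ^ n * Psi_Beta_integrand \<alpha> \<beta> p x y t)"
proof -
  have "of_real t powr (x + of_nat n - 1) = of_real t ^ n * of_real t powr (x - 1)" for t :: real
  proof (cases "t = 0")
    case False
    have "of_real t powr (x + of_nat n - 1) = complex_of_real t powr (of_nat n + (x - 1))"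
      by (simp add: algebra_simps)
    also have "\<dots> = of_real t ^ n * of_real t powr (x - 1)"
      using False by (subst powr_add) (simp add: powr_nat')
    finally show ?thesis .
  qed simp
  then show ?thesis
    unfolding Psi_Beta_def Psi_Beta_integrand_def by (simp add: mult.assoc)
qed

text \<open>
  The integral is holomorphic on the cut plane, and inside the unit disc it is the sum of the
  series, by the binomial expansion of the kernel and termwise integration. By the identity
  theorem it is therefore the only continuation of the series. The radius of convergence may be
  larger than 1, and in that case the definition evaluates the series itself, so the identity
  theorem is also used on the part of the disc of convergence inside the cut plane.
\<close>

lemma Psi_F_eq_integral:
  assumes f: "Psi_Beta_integrand \<alpha> \<beta> p b (c - b) integrable_on {0..1}"
    and z: "z \<in> cut_plane"
  shows "Psi_F \<alpha> \<beta> p a b c z =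
    integral {0..1} (\<lambda>t. (1 - z * of_real t) powr (- a) * Psi_Beta_integrand \<alpha> \<beta> p b (c - b) t)
      / Beta b (c - b)"
proof -
  define f where "f = Psi_Beta_integrand \<alpha> \<beta> p b (c - b)"
  define S where "S = Psi_F_fps \<alpha> \<beta> p a b c"
  define G where "G z = integral {0..1} (\<lambda>t. (1 - z * of_real t) powr (- a) * f t) / Beta b (c - b)" for z
  let ?R = "fps_conv_radius S"
  have S_sums: "(\<lambda>n. fps_nth S n * w ^ n) sums G w" if w: "norm w < 1" for w
  proof -
    define C where "C = Abs_fps (\<lambda>n. pochhammer a n / fact n)"
    have "fps_conv_radius C \<ge> 1"
      using binomial_series_pochhammer[of _ a]
      by (intro fps_conv_radius_ge_1) (auto simp: C_def sums_iff)
    moreover have "ereal (norm w) < 1" using w by (simp add: one_ereal_def)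
    ultimately have "ereal (norm w) < fps_conv_radius C" by (rule less_le_trans[rotated])
    from integral_power_series_times_integrable[OF assms(1) this]
    have "(\<lambda>n. fps_nth C n * integral {0..1} (\<lambda>t. of_real t ^ n * f t) * w ^ n / Beta b (c - b)) sums
        (integral {0..1} (\<lambda>t. eval_fps C (w * of_real t) * f t) / Beta b (c - b))"
      unfolding f_def by (rule sums_divide)
    also have "integral {0..1} (\<lambda>t. eval_fps C (w * of_real t) * f t) =
        integral {0..1} (\<lambda>t. (1 - w * of_real t) powr (- a) * f t)"
    proof (rule integral_cong)
      fix t :: real assume t: "t \<in> {0..1}"
      have "norm (w * of_real t) \<le> norm w" using t by (auto simp: norm_mult mult_left_le)
      with w binomial_series_pochhammer[of "w * of_real t" a]
      show "eval_fps C (w * of_real t) * f t = (1 - w * of_real t) powr (- a) * f t"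
        by (simp add: eval_fps_def C_def sums_iff)
    qed
    finally show ?thesis
      by (simp add: S_def G_def C_def Psi_F_fps_def Psi_Beta_shift f_def mult_ac)
  qed
  have R: "?R \<ge> 1"
    using S_sums by (intro fps_conv_radius_ge_1) (auto simp: sums_iff)
  then have ball: "ball 0 1 \<subseteq> cut_plane \<inter> eball 0 ?R"
    using ball_eball_mono[of 1 ?R 0] unit_ball_subset_cut_plane by (auto simp: one_ereal_def)
  have eval: "eval_fps S w = G w" if "w \<in> ball 0 1" for w
    using S_sums[of w] that by (simp add: eval_fps_def sums_iff)
  have holG: "G holomorphic_on cut_plane"
    unfolding G_def f_def divide_inverse
    by (intro holomorphic_on_mult holomorphic_on_const holomorphic_binomial_kernel_integral assms(1))
  have agree: "G w = eval_fps S w" if "w \<in> cut_plane \<inter> eball 0 ?R" for w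
  proof (rule analytic_continuation_open[of "ball 0 1" "cut_plane \<inter> eball 0 ?R" G "eval_fps S"])
    show "connected (cut_plane \<inter> eball 0 ?R)"
      by (intro connected_cut_plane_eball less_le_trans[OF _ R]) simp
    show "G holomorphic_on cut_plane \<inter> eball 0 ?R"
      using holG by (rule holomorphic_on_subset) auto
    show "eval_fps S holomorphic_on cut_plane \<inter> eball 0 ?R"
      by (rule holomorphic_on_eval_fps) auto
  qed (use ball that open_cut_plane eval in auto)
  have "is_continuation S G"
    using holG agree by (auto simp: is_continuation_def)
  moreover have "g w = G w" if g: "is_continuation S g" and w: "w \<in> cut_plane" for g w
  proof (rule analytic_continuation_open[of "ball 0 1" cut_plane g G])
    show "connected cut_plane"
      using connected_cut_plane_eball[of \<infinity>] by simp
    show "g u = G u" if "u \<in> ball 0 1" for u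
    proof -
      have "u \<in> cut_plane \<inter> eball 0 ?R" using ball that by blast
      then have "g u = eval_fps S u" using g unfolding is_continuation_def by blast
      then show ?thesis using eval[OF that] by simp
    qed
    show "g holomorphic_on cut_plane"
      using g unfolding is_continuation_def by blast
  qed (use w holG open_cut_plane unit_ball_subset_cut_plane in simp_all)
  ultimately have "(THE w. \<exists>g. is_continuation S g \<and> w = g z) = G z"
    using z by (intro the_equality) blast+
  then have "Psi_F \<alpha> \<beta> p a b c z = G z"
    using agree z by (simp add: Psi_F_def S_def Let_def)
  then show ?thesis by (simp add: G_def f_def)
qed

section \<open>The Pfaff transformation\<close>

text \<open>
  With \<open>u = 1 - z\<close> and \<open>v = 1 - z (1 - t)\<close> this is \<open>v = u (v / u)\<close>, raised to the power
  \<open>- a\<close>. Principal powers are multiplicative here because \<open>v\<close> lies on the segment from \<open>1\<close>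
  to \<open>u\<close>, which avoids the nonpositive reals: the imaginary parts of \<open>u\<close> and \<open>v\<close> do not
  have opposite signs, and so the difference of the arguments of \<open>v\<close> and \<open>u\<close> stays strictly
  between \<open>-\<pi>\<close> and \<open>\<pi>\<close>.
\<close>

lemma pfaff_kernel_identity:
  assumes z: "z \<in> cut_plane" and t: "t \<in> {0..1}"
  shows "(1 - z * of_real (1 - t)) powr (- a) =
    (1 - z) powr (- a) * (1 - z / (z - 1) * of_real t) powr (- a)"
proof -
  define u where "u = 1 - z"
  define v where "v = 1 - z * of_real (1 - t)"
  have u: "u \<notin> \<real>\<^sub>\<le>\<^sub>0" and v: "v \<notin> \<real>\<^sub>\<le>\<^sub>0"
    using z cut_plane_scaled[OF z, of "1 - t"] t by (auto simp: cut_plane_iff u_def v_def)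
  then have nz: "u \<noteq> 0" "v \<noteq> 0" by auto
  have q: "v / u = 1 - z / (z - 1) * of_real t"
    using nz by (simp add: u_def v_def divide_simps) (simp add: algebra_simps)
  have Im_uv: "Im v = (1 - t) * Im u" by (simp add: u_def v_def algebra_simps)
  have "-pi < Im (Ln v) - Im (Ln u) \<and> Im (Ln v) - Im (Ln u) < pi"
  proof (cases "Im u" "0 :: real" rule: linorder_cases)
    case less
    then have "Im v \<le> 0" using t Im_uv by (simp add: mult_nonneg_nonpos)
    then have "Im (Ln v) \<le> 0" "Im (Ln u) < 0"
      using less nz v Im_Ln_pos_lt[of v] Im_Ln_pos_le[of u] Im_Ln_le_pi[of u] Im_Ln_le_pi[of v]
        Im_Ln_eq_pi[of v] by (auto simp: complex_nonpos_Reals_iff)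
    then show ?thesis using mpi_less_Im_Ln[of u] mpi_less_Im_Ln[of v] nz by auto
  next
    case equal
    then have "Im (Ln u) = 0" "Im (Ln v) = 0"
      using u v nz Im_uv by (auto simp: Im_Ln_eq_0 complex_nonpos_Reals_iff)
    then show ?thesis by simp
  next
    case greater
    then have "Im v \<ge> 0" using t Im_uv by simp
    then show ?thesis
      using greater nz Im_Ln_pos_lt[of u] Im_Ln_pos_le[of v] v Im_Ln_eq_pi[of v]
      by (auto simp: complex_nonpos_Reals_iff)
  qed
  then have Ln_q: "Ln (v / u) = Ln v - Ln u"
    using nz by (intro Ln_unique) (auto simp: exp_diff)
  have "exp (- a * Ln v) = exp (- a * Ln u) * exp (- a * Ln (v / u))"
    unfolding exp_add[symmetric] Ln_q by (simp add: algebra_simps)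
  then have "v powr (- a) = u powr (- a) * (v / u) powr (- a)"
    using nz by (simp add: powr_def)
  then show ?thesis unfolding q by (simp add: u_def v_def)
qed

text \<open>
  As an equivalence it also transports the divergence of an integral, so that integrals can be
  reflected without checking that they exist.
\<close>

lemma has_integral_reflect_unit_interval:
  fixes g :: "real \<Rightarrow> complex"
  shows "((\<lambda>t. g (1 - t)) has_integral I) {0..1} \<longleftrightarrow> (g has_integral I) {0..1}"
proof -
  have "((\<lambda>t. g (1 - t)) has_integral I) {0..1}" if "(g has_integral I) {0..1}" for g :: "real \<Rightarrow> complex"
  proof -
    have "((\<lambda>t. g (- 1 *\<^sub>R t + 1)) has_integral (1 / \<bar>- 1\<bar> ^ DIM(real)) *\<^sub>R I)
        ((\<lambda>x. (1 / - 1) *\<^sub>R x + - ((1 / - 1) *\<^sub>R 1)) ` cbox 0 1)"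
      by (rule has_integral_affinity) (use that in auto)
    moreover have "(\<lambda>x. 1 - x) ` {0..1} = {0..1 :: real}"
      by (simp add: image_diff_atLeastAtMost)
    ultimately show ?thesis by simp
  qed
  from this[of g] this[of "\<lambda>t. g (1 - t)"] show ?thesis by auto
qed

theorem theorem3p9:
  fixes \<alpha> \<beta> a b c z p :: complex
  assumes "Re \<alpha> > -1"
    and "Re p > 0 \<or> p = 0"
    and "Re c > Re b" and "Re b > 0"
    and "z \<noteq> 1" and "\<bar>Arg (1 - z)\<bar> < pi"
    and integral_converges: "Psi_Beta_integrand \<alpha> \<beta> p b (c - b) integrable_on {0..1}"
  shows "Psi_F \<alpha> \<beta> p a b c z
           = (1 - z) powr (- a) * Psi_F \<alpha> \<beta> p a (c - b) c (z / (z - 1))"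
proof -
  let ?f = "Psi_Beta_integrand \<alpha> \<beta> p b (c - b)"
  let ?f' = "Psi_Beta_integrand \<alpha> \<beta> p (c - b) (c - (c - b))"
  let ?w = "z / (z - 1)"
  have z: "z \<in> cut_plane" using assms by (simp add: cut_plane_def)
  \<comment> \<open>The substitution exchanges the two exponents and fixes the argument \<open>- p / (t (1 - t))\<close> of the Wright function.\<close>
  have f': "?f' t = ?f (1 - t)" for t
    by (simp add: Psi_Beta_integrand_def mult_ac)
  have f'_int: "?f' integrable_on {0..1}"
    using integral_converges
    unfolding f' integrable_on_def has_integral_reflect_unit_interval[of ?f] .
  have w: "?w \<in> cut_plane"
  proof -
    have "1 - ?w = inverse (1 - z)" using \<open>z \<noteq> 1\<close> by (simp add: divide_simps)
    then show ?thesis using z by (simp add: cut_plane_iff nonpos_Reals_inverse_iff)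
  qed
  have "integral {0..1} (\<lambda>t. (1 - z * of_real t) powr (- a) * ?f t) =
      integral {0..1} (\<lambda>t. (1 - z * of_real (1 - t)) powr (- a) * ?f (1 - t))"
    using has_integral_reflect_unit_interval[of "\<lambda>t. (1 - z * of_real t) powr (- a) * ?f t"]
    unfolding integral_def integrable_on_def by simp
  also have "\<dots> = integral {0..1} (\<lambda>t. (1 - z) powr (- a) * ((1 - ?w * of_real t) powr (- a) * ?f' t))"
    by (rule integral_cong) (simp only: pfaff_kernel_identity[OF z] f' mult.assoc)
  also have "\<dots> = (1 - z) powr (- a) * integral {0..1} (\<lambda>t. (1 - ?w * of_real t) powr (- a) * ?f' t)"
    by (rule integral_mult_right)
  finally show ?thesis
    using Psi_F_eq_integral[OF integral_converges z, of a] Psi_F_eq_integral[OF f'_int w, of a]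
    by (simp add: Beta_commute)
qed

end
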